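(* Let $r\ge 2$ and let $\mathcal{H}$ be an $r$-partite $r$-uniform intersecting hypergraph. The maximum number of hyperedges of $\mathcal{H}$ coverable by a multi-colored set of size $r-1$ equals $\big(1-\frac{r-2}{(r-1)^2}\big)\cdot |E(\mathcal{H})|$ if and only if $\mathcal{H}$ can be obtained from a truncated projective plane of order $r-1$ by taking $b$ parallel copies of each hyperedge, for some fixed positive integer $b$.
   Context: A hypergraph has a finite vertex set and a multiset of hyperedges (counted with multiplicity). It is $r$-uniform if all hyperedges have $r$ vertices; $r$-partite if its vertex set has a partition into $r$ nonempty classes such that no hyperedge contains two vertices from the same class; intersecting if any two hyperedges share a vertex. A vertex set is multi-colored if it meets each class in at most one vertex; it covers a hyperedge if it intersects it. The truncated projective plane of order $r-1$ is obtained from a projective plane of order $r-1$ by removing one point $p$ and all lines through $p$; its vertices are the remaining points and its hyperedges the remaining lines. It is $r$-partite $r$-uniform, with the classes being the sets of remaining points on each of the $r$ removed lines.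
   Formalization: The hypergraph must have at least one hyperedge; the truncated-plane structure is asserted after deleting isolated vertices; for r = 2 only the "if" direction is stated, since a star with two leaves and edge multiplicities 2 and 1 refutes "only if". *)

theory Defs
  imports Complex_Main "HOL-Library.Multiset" "HOL-Library.Disjoint_Sets"
begin

definition hypergraph :: "'a set \<Rightarrow> 'a set multiset \<Rightarrow> bool" where
  "hypergraph V E \<longleftrightarrow> finite V \<and> (\<forall>e\<in>#E. e \<subseteq> V)"

definition uniform :: "nat \<Rightarrow> 'a set multiset \<Rightarrow> bool" where
  "uniform r E \<longleftrightarrow> (\<forall>e\<in>#E. card e = r)"

definition intersecting :: "'a set multiset \<Rightarrow> bool" where
  "intersecting E \<longleftrightarrow> (\<forall>e\<in>#E. \<forall>f\<in>#E. e \<inter> f \<noteq> {})"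

text \<open>
  The classes are a parameter, since being multi-colored depends on them;
  \<^const>\<open>partition_on\<close> includes that every class is nonempty.
\<close>

definition partite :: "nat \<Rightarrow> 'a set set \<Rightarrow> 'a set \<Rightarrow> 'a set multiset \<Rightarrow> bool" where
  "partite r C V E \<longleftrightarrow>
     partition_on V C \<and> card C = r \<and> (\<forall>e\<in>#E. \<forall>A\<in>C. card (e \<inter> A) \<le> 1)"

definition multicolored :: "'a set \<Rightarrow> 'a set set \<Rightarrow> 'a set \<Rightarrow> bool" where
  "multicolored V C S \<longleftrightarrow> S \<subseteq> V \<and> (\<forall>A\<in>C. card (S \<inter> A) \<le> 1)"

definition num_covered :: "'a set multiset \<Rightarrow> 'a set \<Rightarrow> nat" where
  "num_covered E S = size {#e \<in># E. S \<inter> e \<noteq> {}#}"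

definition max_covered :: "nat \<Rightarrow> 'a set \<Rightarrow> 'a set set \<Rightarrow> 'a set multiset \<Rightarrow> nat" where
  "max_covered k V C E = Max (num_covered E ` {S. multicolored V C S \<and> card S = k})"

text \<open>
  Nondegeneracy is stated with three non-collinear points rather than with a
  quadrangle, so that the plane of order 1 is the triangle.  For order at least 2
  all lines have at least three points and a quadrangle then exists.
\<close>

definition projective_plane :: "nat \<Rightarrow> 'a set \<Rightarrow> 'a set set \<Rightarrow> bool" where
  "projective_plane n P L \<longleftrightarrow>
     finite P \<and> (\<forall>l\<in>L. l \<subseteq> P \<and> card l = n + 1) \<and>
     (\<forall>x\<in>P. \<forall>y\<in>P. x \<noteq> y \<longrightarrow> (\<exists>!l. l \<in> L \<and> x \<in> l \<and> y \<in> l)) \<and>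
     (\<forall>l\<in>L. \<forall>m\<in>L. l \<noteq> m \<longrightarrow> (\<exists>!x. x \<in> l \<and> x \<in> m)) \<and>
     (\<exists>x\<in>P. \<exists>y\<in>P. \<exists>z\<in>P. x \<noteq> y \<and> x \<noteq> z \<and> y \<noteq> z \<and>
        \<not> (\<exists>l\<in>L. x \<in> l \<and> y \<in> l \<and> z \<in> l))"

definition truncated_projective_plane :: "nat \<Rightarrow> 'a set \<Rightarrow> 'a set set \<Rightarrow> bool" where
  "truncated_projective_plane n W F \<longleftrightarrow>
     (\<exists>P L p. projective_plane n P L \<and> p \<in> P \<and> W = P - {p} \<and> F = {l \<in> L. p \<notin> l})"

definition isomorphic ::
  "'a set \<Rightarrow> 'a set multiset \<Rightarrow> 'b set \<Rightarrow> 'b set multiset \<Rightarrow> bool" where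
  "isomorphic V E V' E' \<longleftrightarrow> (\<exists>f. bij_betw f V V' \<and> image_mset ((`) f) E = E')"

text \<open>
  Up to isomorphism every truncated projective plane lives on the type \<^typ>\<open>nat\<close>.
  The vertex type of the given hypergraph would not do, as it need not have room
  for the removed point.
\<close>

definition copies_of_truncated_plane :: "nat \<Rightarrow> 'a set \<Rightarrow> 'a set multiset \<Rightarrow> bool" where
  "copies_of_truncated_plane n V E \<longleftrightarrow>
     (\<exists>(W :: nat set) F b. truncated_projective_plane n W F \<and> b > 0 \<and>
        isomorphic W (repeat_mset b (mset_set F)) V E)"

text \<open>
  Isolated vertices do not affect which hyperedges are coverable, whereas every
  vertex of a truncated projective plane lies on a hyperedge.  Equality in the
  covering bound can therefore determine the hypergraph only after isolated
  vertices are deleted.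

  For \<open>r = 2\<close> the equality does not determine the hypergraph at all.  Intersecting
  bipartite multigraphs are stars, all edges of which are covered by the centre, and
  the bound is \<open>size E\<close>; but a star with two leaves, with edge multiplicities
  2 and 1, does not consist of parallel copies of a truncated projective plane.
\<close>

definition non_isolated :: "'a set \<Rightarrow> 'a set multiset \<Rightarrow> 'a set" where
  "non_isolated V E = {v \<in> V. \<exists>e\<in>#E. v \<in> e}"

end

theory Submission
  imports Defs
begin

text \<open>
  Put \<open>n = r - 1\<close> and let \<open>m\<close> be the number of hyperedges.  For a vertex \<open>v\<close> of an edge \<open>e\<close>
  the multi-colored set \<open>e - {v}\<close> misses exactly the edges meeting \<open>e\<close> only in \<open>v\<close>, and these
  sets alone determine the extremal hypergraphs.  Assume that each of them misses at least
  \<open>m (n - 1) / n\<^sup>2\<close> edges.  First, no class has more than \<open>n\<close> non-isolated vertices (lemma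
  \<open>class_le\<close>).  Next, adding up the missed edges over \<open>v \<in> e\<close> shows that the degrees along
  every edge sum to at most \<open>(n + 1) m / n\<close>, whence the squared degrees sum to at most
  \<open>(n + 1) m\<^sup>2 / n\<close>; as there are at most \<open>n (n + 1)\<close> vertices, with degree sum \<open>(n + 1) m\<close>,
  the Cauchy-Schwarz inequality is tight and every estimate is an equality.  So all degrees
  are \<open>m / n\<close>, all multiplicities are \<open>m / n\<^sup>2\<close>, and distinct edges share exactly one vertex.
  A new point together with the classes as new lines completes this to a projective plane.

  Conversely, in a truncated plane any two vertices of different classes lie on an edge.  Hence
  among \<open>n\<close> multi-colored vertices the first covers \<open>n\<close> distinct edges and each further one at
  most \<open>n - 1\<close> new ones, and the sets \<open>e - {v}\<close> attain \<open>n + (n - 1)\<^sup>2\<close>.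
\<close>

section \<open>Set systems with one vertex per class, and their completion to a plane\<close>

locale partite_system =
  fixes F C :: "'a set set"
  assumes finite_edges: "finite F" and finite_classes: "finite C"
    and disjoint_classes: "disjoint C" and edges_in_classes: "\<Union>F \<subseteq> \<Union>C"
    and edge_class: "\<lbrakk>e \<in> F; A \<in> C\<rbrakk> \<Longrightarrow> card (e \<inter> A) = 1"
begin

lemma edge_class_unique: "\<lbrakk>e \<in> F; A \<in> C; x \<in> e; x \<in> A; y \<in> e; y \<in> A\<rbrakk> \<Longrightarrow> x = y"
  by (metis edge_class Int_iff card_1_singletonE singletonD)

lemma edge_class_ex: "\<lbrakk>e \<in> F; A \<in> C\<rbrakk> \<Longrightarrow> \<exists>x. x \<in> e \<and> x \<in> A"
  by (metis edge_class Int_iff card_1_singletonE singletonI)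

lemma class_unique: "\<lbrakk>A \<in> C; B \<in> C; x \<in> A; x \<in> B\<rbrakk> \<Longrightarrow> A = B"
  using disjoint_classes by (auto simp: disjoint_def)

lemma edge_eq_UN: "e \<in> F \<Longrightarrow> e = (\<Union>A\<in>C. e \<inter> A)"
  using edges_in_classes by auto

lemma finite_edge: assumes "e \<in> F" shows "finite e"
proof -
  have "finite (\<Union>A\<in>C. e \<inter> A)"
    using finite_classes edge_class[OF assms] by (intro finite_UN_I) (auto intro: card_ge_0_finite)
  then show ?thesis unfolding edge_eq_UN[OF assms, symmetric] .
qed

lemma card_edge: assumes "e \<in> F" shows "card e = card C"
proof -
  have "card (\<Union>A\<in>C. e \<inter> A) = (\<Sum>A\<in>C. card (e \<inter> A))"
    using finite_classes finite_edge[OF assms] disjoint_classes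
    by (intro card_UN_disjoint) (auto simp: disjoint_def)
  then show ?thesis unfolding edge_eq_UN[OF assms, symmetric] using edge_class[OF assms] by simp
qed

lemma finite_vertices: "finite (\<Union>F)"
  using finite_edges finite_edge by auto

text \<open>Each edge has exactly one vertex in \<open>A\<close>, so the edges satisfying
  \<open>Q\<close> are grouped by that vertex. A trivial \<open>Q\<close> makes the degrees in a
  class add up to the total weight; \<open>Q e\<close> as \<open>v \<in> e\<close> makes the
  codegrees with \<open>v\<close> add up to the degree of \<open>v\<close>.\<close>

lemma sum_class:
  assumes "A \<in> C"
  shows "(\<Sum>v\<in>A \<inter> \<Union>F. sum w {e\<in>F. Q e \<and> v \<in> e}) = sum w {e\<in>F. Q e}"
proof -
  let ?g = "\<lambda>e. the_elem (e \<inter> A)"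
  have gA: "?g e \<in> e" "?g e \<in> A" if "e \<in> F" for e
    using edge_class[OF that assms] by (metis Int_iff card_1_singletonE insertI1 the_elem_eq)+
  have g: "v \<in> e \<longleftrightarrow> ?g e = v" if "e \<in> F" "v \<in> A" for e v
    using edge_class_unique[OF that(1) assms _ that(2)] gA[OF that(1)] by blast
  have "(\<Sum>v\<in>A \<inter> \<Union>F. sum w {e\<in>{e\<in>F. Q e}. ?g e = v}) = sum w {e\<in>F. Q e}"
    using finite_edges finite_vertices gA by (intro sum.group) auto
  moreover have "{e\<in>{e\<in>F. Q e}. ?g e = v} = {e\<in>F. Q e \<and> v \<in> e}" if "v \<in> A" for v
    using g that by auto
  ultimately show ?thesis by simp
qed

text \<open>Double counting of incidences. With \<open>g\<close> constantly 1 it evaluates the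
  degree sum; with \<open>g\<close> the degree itself it turns the sum of squared degrees into
  degree sums along edges.\<close>

lemma sum_vertices:
  fixes w :: "'a set \<Rightarrow> real"
  shows "(\<Sum>v\<in>\<Union>F. g v * sum w {e\<in>F. v \<in> e}) = (\<Sum>e\<in>F. w e * sum g e)"
proof -
  have "(\<Sum>v\<in>\<Union>F. sum (\<lambda>e. g v * w e) {e\<in>F. v \<in> e})
      = (\<Sum>e\<in>F. sum (\<lambda>v. g v * w e) {v\<in>\<Union>F. v \<in> e})"
    by (rule sum.swap_restrict[OF finite_vertices finite_edges])
  moreover have "{v\<in>\<Union>F. v \<in> e} = e" if "e \<in> F" for e using that by auto
  ultimately show ?thesis by (simp add: sum_distrib_left mult.commute)
qed

end

text \<open>The dual affine plane of order \<open>n\<close>, described by counts alone. Both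
  directions of the theorem pass through this notion. Order 1, a single edge with two vertices, is
  included because the converse also covers \<open>r = 2\<close>.\<close>

locale linear_partite_system = partite_system +
  fixes n :: nat
  assumes card_classes: "card C = n + 1" and card_edges: "card F = n\<^sup>2" and n_pos: "0 < n"
    and degree: "v \<in> \<Union>F \<Longrightarrow> card {e\<in>F. v \<in> e} = n"
    and linear: "\<lbrakk>e \<in> F; f \<in> F; e \<noteq> f\<rbrakk> \<Longrightarrow> card (e \<inter> f) = 1"
begin

lemma linear_unique: "\<lbrakk>e \<in> F; f \<in> F; x \<in> e; x \<in> f; y \<in> e; y \<in> f; x \<noteq> y\<rbrakk> \<Longrightarrow> e = f"
  by (metis linear Int_iff card_1_singletonE singletonD)

lemma linear_ex: "\<lbrakk>e \<in> F; f \<in> F; e \<noteq> f\<rbrakk> \<Longrightarrow> \<exists>x. x \<in> e \<and> x \<in> f"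
  by (metis linear Int_iff card_1_singletonE singletonI)

lemma edges_nonempty: "F \<noteq> {}"
  using card_edges n_pos by auto

text \<open>The \<open>n\<^sup>2\<close> edges are distributed over the vertices of
  \<open>A\<close>, with \<open>n\<close> edges at each non-isolated vertex.\<close>

lemma card_class: assumes "A \<in> C" shows "card (A \<inter> \<Union>F) = n"
proof -
  have "(\<Sum>v\<in>A \<inter> \<Union>F. card {e\<in>F. v \<in> e}) = card F"
    using sum_class[OF assms, of "\<lambda>_. 1::nat" "\<lambda>_. True"] by simp
  moreover have "(\<Sum>v\<in>A \<inter> \<Union>F. card {e\<in>F. v \<in> e}) = (\<Sum>v\<in>A \<inter> \<Union>F. n)"
    using degree by (intro sum.cong) auto
  ultimately show ?thesis using card_edges n_pos by (simp add: power2_eq_square)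
qed

text \<open>By linearity the \<open>n\<close> edges through \<open>v\<close> meet \<open>B\<close>
  in distinct vertices. Since \<open>B\<close> has just \<open>n\<close> non-isolated vertices, all
  of them are reached, \<open>u\<close> included.\<close>

lemma joined:
  assumes "A \<in> C" "B \<in> C" "A \<noteq> B" "v \<in> A" "u \<in> B" "v \<in> \<Union>F" "u \<in> \<Union>F"
  shows "\<exists>e\<in>F. v \<in> e \<and> u \<in> e"
proof -
  let ?g = "\<lambda>e. the_elem (e \<inter> B)"
  have g: "?g e \<in> e" "?g e \<in> B" if "e \<in> F" for e
    using edge_class[OF that assms(2)] by (metis Int_iff card_1_singletonE insertI1 the_elem_eq)+
  have "v \<notin> B" using class_unique[OF assms(1,2,4)] assms(3) by blast
  have "inj_on ?g {e\<in>F. v \<in> e}"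
  proof (rule inj_onI, clarify)
    fix e f assume "e \<in> F" "f \<in> F" "v \<in> e" "v \<in> f" and eq: "?g e = ?g f"
    have "?g e \<in> e" "?g e \<in> f" "v \<noteq> ?g e"
      using g[OF \<open>e \<in> F\<close>] g[OF \<open>f \<in> F\<close>] eq \<open>v \<notin> B\<close> by auto
    then show "e = f"
      using linear_unique[OF \<open>e \<in> F\<close> \<open>f \<in> F\<close> \<open>v \<in> e\<close> \<open>v \<in> f\<close>] by simp
  qed
  then have "card (?g ` {e\<in>F. v \<in> e}) = card (B \<inter> \<Union>F)"
    using card_class[OF assms(2)] degree[OF assms(6)] by (simp add: card_image)
  moreover have "?g ` {e\<in>F. v \<in> e} \<subseteq> B \<inter> \<Union>F" using g by auto
  ultimately have "?g ` {e\<in>F. v \<in> e} = B \<inter> \<Union>F"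
    using finite_vertices by (intro card_subset_eq) auto
  then obtain e where "e \<in> F" "v \<in> e" "u = ?g e" using assms by auto
  then show ?thesis using g by blast
qed

text \<open>A missed edge still meets \<open>e\<close>, hence in \<open>v\<close>; conversely,
  another edge through \<open>v\<close> shares nothing else with \<open>e\<close>. So exactly the
  edges through \<open>v\<close> other than \<open>e\<close> are missed.\<close>

lemma card_missed:
  assumes "e \<in> F" "v \<in> e"
  shows "card {f\<in>F. (e - {v}) \<inter> f = {}} = n - 1"
proof -
  \<comment> \<open>As \<open>n > 0\<close>, some vertex of \<open>e\<close> remains, so
    \<open>e\<close> itself is not missed.\<close>
  have "card (e - {v}) = n"
    using card_edge[OF assms(1)] card_classes assms(2) finite_edge[OF assms(1)] by simp
  then have ne: "e - {v} \<noteq> {}" using n_pos by force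
  have "{f\<in>F. (e - {v}) \<inter> f = {}} = {f\<in>F. v \<in> f} - {e}"
  proof (intro set_eqI iffI; clarify)
    fix f assume f: "f \<in> F" "(e - {v}) \<inter> f = {}"
    then have "f \<noteq> e" using ne by auto
    then obtain x where "x \<in> e" "x \<in> f" using linear_ex[OF assms(1) f(1)] by auto
    then show "f \<in> {f\<in>F. v \<in> f} - {e}" using f \<open>f \<noteq> e\<close> by auto
  next
    fix f assume f: "f \<in> F" "v \<in> f" "f \<notin> {}" "f \<noteq> e"
    then show "(e - {v}) \<inter> f = {}" using linear_unique[OF assms(1) f(1) assms(2)] by blast
  qed
  moreover have "card ({f\<in>F. v \<in> f} - {e}) = card {f\<in>F. v \<in> f} - 1"
    using assms finite_edges by (intro card_Diff_singleton) auto
  ultimately show ?thesis using degree[of v] assms by auto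
qed

text \<open>The first vertex \<open>s\<close> is chosen non-isolated. Any other non-isolated vertex
  of \<open>S\<close> lies in a different class, so \<open>joined\<close> gives an edge through it
  that \<open>s\<close> covers already; an isolated vertex covers nothing.\<close>

lemma card_covered_le:
  assumes "S \<subseteq> \<Union>C" "\<And>A. A \<in> C \<Longrightarrow> card (S \<inter> A) \<le> 1" "finite S" "card S = n"
  shows "card {e\<in>F. S \<inter> e \<noteq> {}} \<le> n + (n - 1) * (n - 1)"
proof (cases "S \<inter> \<Union>F = {}")
  case True
  then have "{e\<in>F. S \<inter> e \<noteq> {}} = {}" by blast
  then show ?thesis by (metis card.empty le0)
next
  case False
  then obtain s where s: "s \<in> S" "s \<in> \<Union>F" by auto
  let ?D = "\<lambda>x. {e\<in>F. x \<in> e \<and> s \<notin> e}"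
  have D: "card (?D x) \<le> n - 1" if x: "x \<in> S - {s}" for x
  proof (cases "x \<in> \<Union>F")
    case True
    obtain A B where AB: "A \<in> C" "B \<in> C" "s \<in> A" "x \<in> B" using s x assms(1) by blast
    have "A \<noteq> B"
    proof
      assume "A = B"
      then have "{s, x} \<subseteq> S \<inter> A" using AB s x by auto
      then have "card {s, x} \<le> card (S \<inter> A)" using assms(3) by (intro card_mono) auto
      then show False using assms(2)[OF AB(1)] x by auto
    qed
    then obtain e where e: "e \<in> F" "s \<in> e" "x \<in> e"
      using joined[OF AB(1,2) _ AB(3,4) s(2) True] by auto
    then have "card (?D x) \<le> card ({e\<in>F. x \<in> e} - {e})"
      using finite_edges by (intro card_mono) auto
    also have "\<dots> = card {e\<in>F. x \<in> e} - 1"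
      using e finite_edges by (intro card_Diff_singleton) auto
    finally show ?thesis using degree[OF True] by simp
  next
    case False
    then have "?D x = {}" by blast
    then show ?thesis by (metis card.empty le0)
  qed
  have "{e\<in>F. S \<inter> e \<noteq> {}} \<subseteq> {e\<in>F. s \<in> e} \<union> (\<Union>x\<in>S - {s}. ?D x)" by auto
  then have "card {e\<in>F. S \<inter> e \<noteq> {}} \<le> card ({e\<in>F. s \<in> e} \<union> (\<Union>x\<in>S - {s}. ?D x))"
    using finite_edges assms(3) by (intro card_mono) auto
  also have "\<dots> \<le> card {e\<in>F. s \<in> e} + card (\<Union>x\<in>S - {s}. ?D x)" by (rule card_Un_le)
  also have "card (\<Union>x\<in>S - {s}. ?D x) \<le> (\<Sum>x\<in>S - {s}. card (?D x))"
    using assms(3) by (intro card_UN_le) auto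
  also have "\<dots> \<le> (\<Sum>x\<in>S - {s}. n - 1)" using D by (intro sum_mono)
  also have "\<dots> = (n - 1) * (n - 1)" using assms s by simp
  finally show ?thesis using degree[OF s(2)] by simp
qed

text \<open>\<open>None\<close> is the restored point, and each class, stripped of isolated
  vertices, becomes a line through it. Vertices of one class are joined by its line, vertices of
  different classes by an edge. Any two lines share exactly one point, which also makes joining
  lines unique.\<close>

lemma projective_plane_closure:
  "projective_plane n (insert None (Some ` \<Union>F))
     ((`) Some ` F \<union> (\<lambda>A. insert None (Some ` (A \<inter> \<Union>F))) ` C)"
  (is "projective_plane n ?P (?L1 \<union> ?L2)")
proof -
  let ?ln = "\<lambda>A. insert None (Some ` (A \<inter> \<Union>F))"
  have cards: "l \<subseteq> ?P \<and> card l = n + 1" if "l \<in> ?L1 \<union> ?L2" for l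
    using that
  proof
    assume "l \<in> ?L1"
    then obtain e where "e \<in> F" "l = Some ` e" by auto
    then show ?thesis using card_edge card_classes by (auto simp: card_image)
  next
    assume "l \<in> ?L2"
    then obtain A where "A \<in> C" "l = ?ln A" by auto
    then show ?thesis using card_class[of A] finite_vertices
      by (auto simp: card_image card_insert_if)
  qed
  have cl: "\<exists>A\<in>C. x \<in> A" if "x \<in> \<Union>F" for x using that edges_in_classes by blast
  have ex_line: "\<exists>l. l \<in> ?L1 \<union> ?L2 \<and> x \<in> l \<and> y \<in> l" if xy: "x \<in> ?P" "y \<in> ?P" "x \<noteq> y" for x y
  proof (cases x)
    case None
    then obtain v where v: "y = Some v" "v \<in> \<Union>F" using xy by auto
    then show ?thesis using cl[of v] None by blast
  next
    case (Some u)
    then have u: "u \<in> \<Union>F" using xy by auto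
    then obtain A where A: "A \<in> C" "u \<in> A" using cl by blast
    show ?thesis
    proof (cases y)
      case None
      then show ?thesis using u A Some by blast
    next
      case S2: (Some v)
      then have v: "v \<in> \<Union>F" using xy by auto
      then obtain B where B: "B \<in> C" "v \<in> B" using cl by blast
      show ?thesis
      proof (cases "A = B")
        case True
        then show ?thesis using A B u v Some S2 by blast
      next
        case False
        then obtain e where "e \<in> F" "u \<in> e" "v \<in> e"
          using joined[OF A(1) B(1) _ A(2) B(2) u v] by auto
        then show ?thesis using Some S2 by blast
      qed
    qed
  qed
  have mixed: "card (Some ` e \<inter> ?ln A) = 1" if "e \<in> F" "A \<in> C" for e A
  proof -
    have "Some ` e \<inter> ?ln A = Some ` (e \<inter> A)" using that by auto
    then show ?thesis using edge_class[OF that] by (simp add: card_image)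
  qed
  have meet: "card (l \<inter> m) = 1" if lm: "l \<in> ?L1 \<union> ?L2" "m \<in> ?L1 \<union> ?L2" "l \<noteq> m" for l m
  proof -
    have "(\<exists>e\<in>F. k = Some ` e) \<or> (\<exists>A\<in>C. k = ?ln A)" if "k \<in> ?L1 \<union> ?L2" for k
      using that by auto
    from this[OF lm(1)] this[OF lm(2)]
    consider e f where "e \<in> F" "f \<in> F" "l = Some ` e" "m = Some ` f"
      | e A where "e \<in> F" "A \<in> C" "l = Some ` e" "m = ?ln A"
      | e A where "e \<in> F" "A \<in> C" "m = Some ` e" "l = ?ln A"
      | A B where "A \<in> C" "B \<in> C" "l = ?ln A" "m = ?ln B"
      by metis
    then show ?thesis
    proof cases
      case 1
      then have "l \<inter> m = Some ` (e \<inter> f)" "e \<noteq> f" using lm(3) by auto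
      then show ?thesis using linear[OF 1(1,2)] by (simp add: card_image)
    next
      case 2
      then show ?thesis using mixed by simp
    next
      case 3
      then show ?thesis using mixed by (simp add: Int_commute)
    next
      case 4
      then have "A \<noteq> B" using lm(3) by auto
      then have "l \<inter> m = {None}" using class_unique[OF 4(1,2)] 4(3,4) by auto
      then show ?thesis by simp
    qed
  qed
  have "\<exists>x\<in>?P. \<exists>y\<in>?P. \<exists>z\<in>?P. x \<noteq> y \<and> x \<noteq> z \<and> y \<noteq> z \<and>
      \<not> (\<exists>l\<in>?L1 \<union> ?L2. x \<in> l \<and> y \<in> l \<and> z \<in> l)"
  \<comment> \<open>The triangle consists of \<open>None\<close> and one vertex from each of two
    classes: edges avoid \<open>None\<close>, and no class contains both vertices. This works for
    order 1 too.\<close>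
  proof -
    have "1 < card C" using card_classes n_pos by simp
    then obtain A B where AB: "A \<in> C" "B \<in> C" "A \<noteq> B"
      by (metis card_le_Suc0_iff_eq finite_classes One_nat_def not_le)
    obtain e where "e \<in> F" using edges_nonempty by auto
    then obtain a b where ab: "a \<in> A" "b \<in> B" "a \<in> \<Union>F" "b \<in> \<Union>F"
      using edge_class_ex[of e A] edge_class_ex[of e B] AB by auto
    have "a \<noteq> b" using ab class_unique[OF AB(1,2)] AB(3) by auto
    moreover have "\<not> (\<exists>l\<in>?L1 \<union> ?L2. None \<in> l \<and> Some a \<in> l \<and> Some b \<in> l)"
      using ab class_unique[OF AB(1) _ ab(1)] class_unique[OF AB(2) _ ab(2)] AB(3) by auto
    ultimately show ?thesis using ab(3,4)
      by (rule_tac bexI[where x=None], rule_tac bexI[where x="Some a"],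
          rule_tac bexI[where x="Some b"]) simp_all
  qed
  moreover have "finite ?P" using finite_vertices by simp
  moreover have "\<exists>!l. l \<in> ?L1 \<union> ?L2 \<and> x \<in> l \<and> y \<in> l" if "x \<in> ?P" "y \<in> ?P" "x \<noteq> y" for x y
  proof (rule ex_ex1I[OF ex_line[OF that]], rule ccontr)
    fix l m
    assume lm: "l \<in> ?L1 \<union> ?L2 \<and> x \<in> l \<and> y \<in> l" "m \<in> ?L1 \<union> ?L2 \<and> x \<in> m \<and> y \<in> m" "l \<noteq> m"
    then have "card (l \<inter> m) = 1" by (intro meet) simp_all
    then obtain z where "l \<inter> m = {z}" by (rule card_1_singletonE)
    moreover have "x \<in> l \<inter> m" "y \<in> l \<inter> m" using lm by simp_all
    ultimately show False using that(3) by simp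
  qed
  moreover have "\<exists>!x. x \<in> l \<and> x \<in> m" if "l \<in> ?L1 \<union> ?L2" "m \<in> ?L1 \<union> ?L2" "l \<noteq> m" for l m
    using meet[OF that] by (metis Int_iff card_1_singletonE singletonD singletonI)
  ultimately show ?thesis unfolding projective_plane_def
    using cards by (intro conjI ballI impI) simp_all
qed

end

section \<open>Averaging and the extremal weighted systems\<close>

lemma ex_le_average:
  fixes g :: "'b \<Rightarrow> real"
  assumes "finite S" "S \<noteq> {}"
  shows "\<exists>v\<in>S. real (card S) * g v \<le> sum g S"
proof (rule ccontr)
  assume "\<not> ?thesis"
  then have "(\<Sum>v\<in>S. sum g S) < (\<Sum>v\<in>S. real (card S) * g v)"
    using assms by (intro sum_strict_mono) auto
  then show False by (simp flip: sum_distrib_left)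
qed

lemma ex_ge_average:
  fixes g :: "'b \<Rightarrow> real"
  assumes "finite S" "S \<noteq> {}"
  shows "\<exists>v\<in>S. sum g S \<le> real (card S) * g v"
  using ex_le_average[OF assms, of "\<lambda>v. - g v"] by (simp add: sum_negf)

context partite_system
begin

text \<open>The weights \<open>w\<close> are to be edge multiplicities and \<open>m\<close> the
  number of hyperedges with multiplicity. The covering bound enters only through
  \<open>missed\<close>, and \<open>n2\<close> rules out the stars of the case
  \<open>r = 2\<close>.\<close>

context
  fixes w :: "'a set \<Rightarrow> real" and n :: nat and m :: real
  assumes card_C: "card C = n + 1" and n2: "2 \<le> n" and nonempty: "F \<noteq> {}"
    and w_pos: "\<And>e. e \<in> F \<Longrightarrow> 0 < w e" and m_def: "m = sum w F"
    and meet: "\<And>e f. \<lbrakk>e \<in> F; f \<in> F\<rbrakk> \<Longrightarrow> e \<inter> f \<noteq> {}"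
    and missed: "\<And>e v. \<lbrakk>e \<in> F; v \<in> e\<rbrakk> \<Longrightarrow>
        (real n - 1) / (real n)\<^sup>2 * m \<le> sum w {f\<in>F. (e - {v}) \<inter> f = {}}"
begin

lemma m_pos: "0 < m"
  unfolding m_def using finite_edges nonempty w_pos by (rule sum_pos)

lemma weight_pos: "\<lbrakk>f \<in> F; Q f\<rbrakk> \<Longrightarrow> 0 < sum w {e\<in>F. Q e}"
  using finite_edges w_pos by (intro sum_pos2[of _ f]) (auto intro: less_imp_le)

text \<open>
  If \<open>v\<close> has least degree in a largest class, of size \<open>k\<close>, and \<open>u\<close> has the largest
  codegree with \<open>v\<close> in another class, then some edge \<open>e\<close> contains both, and \<open>e - {v}\<close>
  misses at most the fraction \<open>(1/k) (1 - 1/k)\<close> of the weight.  For \<open>k > n\<close> this is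
  less than \<open>(1/n) (1 - 1/n)\<close>.
\<close>

lemma class_le:
  assumes "A \<in> C"
  shows "card (A \<inter> \<Union>F) \<le> n"
proof -
  let ?k = "\<lambda>A. card (A \<inter> \<Union>F)"
  have ne: "C \<noteq> {}" using assms by auto
  obtain A0 where A0: "A0 \<in> C" and max: "\<And>B. B \<in> C \<Longrightarrow> ?k B \<le> ?k A0"
  proof -
    have "Max (?k ` C) \<in> ?k ` C" using finite_classes ne by (intro Max_in) auto
    then obtain A0 where "A0 \<in> C" "Max (?k ` C) = ?k A0" by blast
    moreover have "?k B \<le> Max (?k ` C)" if "B \<in> C" for B
      using finite_classes that by (intro Max_ge) auto
    ultimately show thesis using that by metis
  qed
  define k where "k = ?k A0"
  obtain e0 where e0: "e0 \<in> F" using nonempty by auto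
  have class_ne: "B \<inter> \<Union>F \<noteq> {}" if "B \<in> C" for B
    using edge_class_ex[OF e0 that] e0 by blast
  have class_fin: "finite (B \<inter> \<Union>F)" for B using finite_vertices by simp
  have kpos: "0 < k" unfolding k_def using class_ne[OF A0] class_fin by (simp add: card_gt_0_iff)
  let ?d = "\<lambda>v. sum w {e\<in>F. v \<in> e}"
  obtain v where v: "v \<in> A0" "v \<in> \<Union>F" and dv: "k * ?d v \<le> m"
    using ex_le_average[OF class_fin class_ne[OF A0], of ?d] sum_class[OF A0, of w "\<lambda>_. True"]
    unfolding k_def m_def by auto
  have "\<exists>B\<in>C. B \<noteq> A0"
  proof (rule ccontr)
    assume "\<not> ?thesis"
    then have "C \<subseteq> {A0}" by auto
    then have "card C \<le> card {A0}" by (intro card_mono) auto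
    then show False using card_C n2 by simp
  qed
  then obtain B where B: "B \<in> C" "B \<noteq> A0" by auto
  let ?c = "\<lambda>u. sum w {e\<in>F. v \<in> e \<and> u \<in> e}"
  obtain u where u: "u \<in> B" and cu: "?d v \<le> ?k B * ?c u"
    using ex_ge_average[OF class_fin class_ne[OF B(1)], of ?c]
      sum_class[OF B(1), of w "\<lambda>e. v \<in> e"] by auto
  obtain e1 where "e1 \<in> F" "v \<in> e1" using v by auto
  then have dpos: "0 < ?d v" by (rule weight_pos)
  \<comment> \<open>The codegree of \<open>u\<close> is at least the average of codegrees whose sum
    is positive, so some edge contains both \<open>v\<close> and \<open>u\<close>.\<close>
  then have "?c u \<noteq> 0" using cu by auto
  then have "{e\<in>F. v \<in> e \<and> u \<in> e} \<noteq> {}" by fastforce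
  then obtain e where e: "e \<in> F" "v \<in> e" "u \<in> e" by auto
  have cpos: "0 \<le> ?c u" using w_pos by (intro sum_nonneg) (auto intro: less_imp_le)
  have "?d v \<le> ?k B * ?c u" by (rule cu)
  also have "\<dots> \<le> k * ?c u"
    unfolding k_def using max[OF B(1)] cpos by (intro mult_right_mono) auto
  finally have duv: "?d v \<le> k * ?c u" .
  have "u \<noteq> v" using class_unique[OF A0 B(1) v(1)] u B(2) by auto
  \<comment> \<open>A missed edge meets \<open>e\<close>, so it meets it in \<open>v\<close>; and it
    avoids \<open>u\<close>, which is in \<open>e - {v}\<close>.\<close>
  have "{f\<in>F. (e - {v}) \<inter> f = {}} \<subseteq> {f\<in>F. v \<in> f} - {f\<in>F. v \<in> f \<and> u \<in> f}"
    using meet[OF e(1)] e \<open>u \<noteq> v\<close> by blast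
  then have "sum w {f\<in>F. (e - {v}) \<inter> f = {}} \<le> sum w ({f\<in>F. v \<in> f} - {f\<in>F. v \<in> f \<and> u \<in> f})"
    using finite_edges w_pos by (intro sum_mono2) (auto intro: less_imp_le)
  also have "\<dots> = ?d v - ?c u" using finite_edges by (intro sum_diff) auto
  finally have "(real n - 1) / (real n)\<^sup>2 * m \<le> ?d v - ?c u"
    using missed[OF e(1,2)] by linarith
  then have "(real n - 1) * m \<le> (?d v - ?c u) * (real n)\<^sup>2"
    using n2 by (simp add: field_simps)
  \<comment> \<open>The factor \<open>k\<^sup>2\<close> clears the denominators of both averages:
    first \<open>k * ?c u\<close> is replaced by its lower bound \<open>?d v\<close>, then
    \<open>k * ?d v\<close> by its upper bound \<open>m\<close>.\<close>
  then have "(real k)\<^sup>2 * ((real n - 1) * m) \<le> (real k)\<^sup>2 * ((?d v - ?c u) * (real n)\<^sup>2)"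
    by (intro mult_left_mono) auto
  also have "\<dots> = (k * (k * ?d v) - k * (k * ?c u)) * (real n)\<^sup>2"
    by (simp add: algebra_simps power2_eq_square)
  also have "\<dots> \<le> (k * (k * ?d v) - k * ?d v) * (real n)\<^sup>2"
    using duv by (intro mult_right_mono diff_left_mono mult_left_mono) auto
  also have "\<dots> = (real k - 1) * (k * ?d v) * (real n)\<^sup>2"
    by (simp add: algebra_simps)
  also have "\<dots> \<le> (real k - 1) * m * (real n)\<^sup>2"
    using dv kpos by (intro mult_right_mono mult_left_mono) auto
  finally have "((real k)\<^sup>2 * (real n - 1)) * m \<le> ((real k - 1) * (real n)\<^sup>2) * m"
    by (simp add: algebra_simps)
  then have "(real k)\<^sup>2 * (real n - 1) \<le> (real k - 1) * (real n)\<^sup>2"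
    using m_pos by (simp add: mult_le_cancel_right)
  \<comment> \<open>The difference of the two sides factors. For \<open>k > n \<ge> 2\<close> both
    factors are positive, the second being at least 1.\<close>
  then have le0: "(real k - real n) * ((real n - 1) * (real k - 1) - 1) \<le> 0"
    by (simp add: algebra_simps power2_eq_square)
  have "k \<le> n"
  proof (rule ccontr)
    assume "\<not> k \<le> n"
    then have k: "real k \<ge> real n + 1" by simp
    then have "1 * 2 \<le> (real n - 1) * (real k - 1)" using n2 by (intro mult_mono) auto
    then have "0 < (real k - real n) * ((real n - 1) * (real k - 1) - 1)"
      using k by (intro mult_pos_pos) auto
    then show False using le0 by simp
  qed
  then show ?thesis using max[OF assms] unfolding k_def by simp
qed

lemma card_vertices_le: "card (\<Union>F) \<le> n * (n + 1)"
proof -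
  have "\<Union>F = (\<Union>A\<in>C. A \<inter> \<Union>F)" using edges_in_classes by auto
  then have "card (\<Union>F) \<le> (\<Sum>A\<in>C. card (A \<inter> \<Union>F))"
    using card_UN_le[OF finite_classes, of "\<lambda>A. A \<inter> \<Union>F"] by simp
  also have "\<dots> \<le> (\<Sum>A\<in>C. n)" by (intro sum_mono class_le)
  finally show ?thesis using card_C by (simp add: mult.commute)
qed

lemma real_card_edge: "e \<in> F \<Longrightarrow> real (card e) = real n + 1"
  using card_edge card_C by simp

text \<open>
  The last count is \<open>1\<close> or \<open>0\<close> according to whether \<open>f\<close> meets \<open>e\<close> in one vertex or in more.
  So the defect is nonnegative, and it vanishes only if \<open>e\<close> and \<open>f\<close> share one vertex or
  all vertices.
\<close>

definition defect :: "'a set \<Rightarrow> 'a set \<Rightarrow> real" where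
  "defect e f = real n + 1 - card (e \<inter> f) - n * card {v\<in>e. (e - {v}) \<inter> f = {}}"

lemma defect_cases:
  assumes "e \<in> F" "f \<in> F"
  shows "card (e \<inter> f) = 1 \<and> defect e f = 0 \<or>
    1 < card (e \<inter> f) \<and> defect e f = real n + 1 - card (e \<inter> f)"
proof -
  have fin: "finite (e \<inter> f)" using finite_edge[OF assms(1)] by simp
  have "card (e \<inter> f) \<noteq> 0" using meet[OF assms] fin by simp
  then consider "card (e \<inter> f) = 1" | "1 < card (e \<inter> f)" by linarith
  then show ?thesis
  proof cases
    case 1
    then obtain x where x: "e \<inter> f = {x}" by (rule card_1_singletonE)
    then have "{v\<in>e. (e - {v}) \<inter> f = {}} = {x}" by blast
    then show ?thesis using 1 unfolding defect_def by simp
  next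
    case 2
    have none: "{v\<in>e. (e - {v}) \<inter> f = {}} = {}"
    proof (rule ccontr)
      assume "\<not> ?thesis"
      then obtain v where "e \<inter> f \<subseteq> {v}" by blast
      then have "card (e \<inter> f) \<le> card {v}" by (intro card_mono) auto
      then show False using 2 by simp
    qed
    show ?thesis using 2 unfolding defect_def none by simp
  qed
qed

lemma defect_nonneg: assumes "e \<in> F" "f \<in> F" shows "0 \<le> defect e f"
proof -
  have "card (e \<inter> f) \<le> card e" using finite_edge[OF assms(1)] by (intro card_mono) auto
  then show ?thesis using defect_cases[OF assms] real_card_edge[OF assms(1)] by auto
qed

lemma sum_degree:
  assumes "e \<in> F"
  shows "(\<Sum>v\<in>e. sum w {f\<in>F. v \<in> f}) = (\<Sum>f\<in>F. w f * card (e \<inter> f))"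
proof -
  have "(\<Sum>v\<in>e. sum w {f\<in>F. v \<in> f}) = (\<Sum>f\<in>F. \<Sum>v\<in>{v\<in>e. v \<in> f}. w f)"
    by (rule sum.swap_restrict[OF finite_edge[OF assms] finite_edges])
  also have "\<dots> = (\<Sum>f\<in>F. w f * card (e \<inter> f))"
    by (simp add: Int_def mult.commute)
  finally show ?thesis .
qed

text \<open>By the definition of \<open>defect\<close>, each edge \<open>f\<close> contributes
  \<open>w f * (n + 1)\<close> to the degrees along \<open>e\<close>, plus \<open>n\<close> times
  the missed weights, plus the defects. Bounding the missed weight from below at each of the
  \<open>n + 1\<close> vertices of \<open>e\<close> leaves \<open>(n + 1) * m / n\<close> for the
  rest.\<close>

lemma sum_degree_le:
  assumes "e \<in> F"
  shows "(\<Sum>v\<in>e. sum w {f\<in>F. v \<in> f}) + (\<Sum>f\<in>F. w f * defect e f) \<le> (n + 1) * m / n"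
proof -
  let ?U = "\<lambda>v. sum w {f\<in>F. (e - {v}) \<inter> f = {}}"
  have "(\<Sum>v\<in>e. ?U v) = (\<Sum>f\<in>F. \<Sum>v\<in>{v\<in>e. (e - {v}) \<inter> f = {}}. w f)"
    by (rule sum.swap_restrict[OF finite_edge[OF assms] finite_edges])
  also have "\<dots> = (\<Sum>f\<in>F. w f * card {v\<in>e. (e - {v}) \<inter> f = {}})"
    by (simp add: mult.commute)
  finally have "(\<Sum>v\<in>e. sum w {f\<in>F. v \<in> f}) + n * (\<Sum>v\<in>e. ?U v) + (\<Sum>f\<in>F. w f * defect e f)
      = (\<Sum>f\<in>F. w f * (n + 1))"
    unfolding sum_degree[OF assms] defect_def
    by (simp add: sum_distrib_left algebra_simps flip: sum.distrib sum_subtractf)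
  also have "\<dots> = (n + 1) * m" by (simp add: m_def mult.commute flip: sum_distrib_right)
  finally have eq: "(\<Sum>v\<in>e. sum w {f\<in>F. v \<in> f}) + (\<Sum>f\<in>F. w f * defect e f)
      = (n + 1) * m - n * (\<Sum>v\<in>e. ?U v)" by simp
  have "(\<Sum>v\<in>e. (real n - 1) / (real n)\<^sup>2 * m) \<le> (\<Sum>v\<in>e. ?U v)"
    using missed[OF assms] by (intro sum_mono)
  then have "(real n + 1) * ((real n - 1) / (real n)\<^sup>2 * m) \<le> (\<Sum>v\<in>e. ?U v)"
    using real_card_edge[OF assms] by simp
  then have "n * ((real n + 1) * ((real n - 1) / (real n)\<^sup>2 * m)) \<le> n * (\<Sum>v\<in>e. ?U v)"
    by (intro mult_left_mono) auto
  moreover have "(n + 1) * m - n * ((real n + 1) * ((real n - 1) / (real n)\<^sup>2 * m)) = (n + 1) * m / n"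
    using n2 by (simp add: field_simps power2_eq_square)
  ultimately show ?thesis using eq by linarith
qed

lemma degree_eq:
  assumes "v \<in> \<Union>F"
  shows "sum w {e\<in>F. v \<in> e} = m / n"
proof -
  let ?d = "\<lambda>v. sum w {e\<in>F. v \<in> e}"
  have "(\<Sum>v\<in>\<Union>F. ?d v * ?d v) = (\<Sum>e\<in>F. w e * sum ?d e)"
    by (rule sum_vertices)
  also have "\<dots> \<le> (\<Sum>e\<in>F. w e * ((n + 1) * m / n))"
  proof (intro sum_mono mult_left_mono)
    fix e assume e: "e \<in> F"
    have "0 \<le> (\<Sum>f\<in>F. w f * defect e f)"
      using defect_nonneg[OF e] w_pos by (intro sum_nonneg mult_nonneg_nonneg) (auto intro: less_imp_le)
    then show "sum ?d e \<le> (n + 1) * m / n" using sum_degree_le[OF e] by linarith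
    show "0 \<le> w e" using w_pos[OF e] by simp
  qed
  also have "\<dots> = m * ((n + 1) * m / n)"
    unfolding m_def by (rule sum_distrib_right[symmetric])
  finally have sq: "(\<Sum>v\<in>\<Union>F. ?d v * ?d v) \<le> m * ((n + 1) * m / n)" .
  have "(\<Sum>v\<in>\<Union>F. 1 * ?d v) = (\<Sum>e\<in>F. w e * sum (\<lambda>_. 1) e)"
    by (rule sum_vertices)
  also have "\<dots> = (\<Sum>e\<in>F. w e * (n + 1))"
    using real_card_edge by (intro sum.cong) auto
  also have "\<dots> = (n + 1) * m" by (simp add: m_def mult.commute flip: sum_distrib_right)
  finally have lin: "(\<Sum>v\<in>\<Union>F. ?d v) = (n + 1) * m" by simp
  \<comment> \<open>Cauchy-Schwarz in variance form. The mean would be \<open>m / n\<close> if there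
    were \<open>n * (n + 1)\<close> vertices; the upper bound on their number suffices, since it
    multiplies a square. The three bounds then add up to 0.\<close>
  have "(\<Sum>v\<in>\<Union>F. (?d v - m / n)\<^sup>2)
      = (\<Sum>v\<in>\<Union>F. ?d v * ?d v - 2 * (m / n) * ?d v + (m / n)\<^sup>2)"
    by (simp add: power2_eq_square algebra_simps)
  also have "\<dots> = (\<Sum>v\<in>\<Union>F. ?d v * ?d v) - 2 * (m / n) * (\<Sum>v\<in>\<Union>F. ?d v) + card (\<Union>F) * (m / n)\<^sup>2"
    by (simp only: sum.distrib sum_subtractf sum_distrib_left[symmetric] sum_constant)
  also have "\<dots> \<le> m * ((n + 1) * m / n) - 2 * (m / n) * ((n + 1) * m) + real (n * (n + 1)) * (m / n)\<^sup>2"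
    unfolding lin using sq card_vertices_le
    by (intro add_mono diff_right_mono mult_right_mono) (simp_all only: of_nat_le_iff zero_le_power2)
  also have "\<dots> = 0" using n2 by (simp add: field_simps power2_eq_square)
  finally have "(\<Sum>v\<in>\<Union>F. (?d v - m / n)\<^sup>2) = 0"
    by (intro antisym sum_nonneg) auto
  then have "(?d v - m / n)\<^sup>2 = 0"
    using finite_vertices assms by (subst (asm) sum_nonneg_eq_0_iff) auto
  then show ?thesis by simp
qed

text \<open>Constant degrees exhaust the bound of \<open>sum_degree_le\<close>, leaving nothing for
  the defects. As the weights are positive, every defect is 0, and for distinct edges this leaves
  only a single common vertex.\<close>

lemma extremal_linear:
  assumes "e \<in> F" "f \<in> F" "e \<noteq> f"
  shows "card (e \<inter> f) = 1"
proof -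
  have "(\<Sum>v\<in>e. sum w {f\<in>F. v \<in> f}) = (\<Sum>v\<in>e. m / n)"
    using assms(1) by (intro sum.cong degree_eq) auto
  also have "\<dots> = (n + 1) * m / n" using real_card_edge[OF assms(1)] by simp
  finally have "(\<Sum>f\<in>F. w f * defect e f) \<le> 0" using sum_degree_le[OF assms(1)] by simp
  moreover have nn: "0 \<le> w f * defect e f" if "f \<in> F" for f
    using that w_pos[OF that] defect_nonneg[OF assms(1) that] by simp
  ultimately have "(\<Sum>f\<in>F. w f * defect e f) = 0" by (intro antisym sum_nonneg) auto
  then have "w f * defect e f = 0"
    using sum_nonneg_eq_0_iff[OF finite_edges nn] assms(2) by simp
  then have z: "defect e f = 0" using w_pos[OF assms(2)] by simp
  have "card (e \<inter> f) \<noteq> n + 1"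
  proof
    assume c: "card (e \<inter> f) = n + 1"
    have "e \<inter> f = e" "e \<inter> f = f"
      using c card_edge card_C finite_edge assms
      by (intro card_subset_eq; simp)+
    then show False using assms(3) by simp
  qed
  then show ?thesis using defect_cases[OF assms(1,2)] z by auto
qed

text \<open>In the degree sum along \<open>e\<close>, every other edge is counted once and
  \<open>e\<close> itself \<open>n + 1\<close> times. The sum is therefore
  \<open>m + n * w e\<close>, while constant degrees make it \<open>(n + 1) * m / n\<close>.\<close>

lemma extremal_weight:
  assumes "e \<in> F"
  shows "w e = m / (real n)\<^sup>2"
proof -
  have "(n + 1) * m / n = (\<Sum>v\<in>e. m / n)" using real_card_edge[OF assms] by simp
  also have "\<dots> = (\<Sum>v\<in>e. sum w {f\<in>F. v \<in> f})"
    using assms by (intro sum.cong degree_eq[symmetric]) auto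
  also have "\<dots> = (\<Sum>f\<in>F. w f * card (e \<inter> f))" by (rule sum_degree[OF assms])
  also have "\<dots> = w e * card e + (\<Sum>f\<in>F - {e}. w f * card (e \<inter> f))"
    using sum.remove[OF finite_edges assms, of "\<lambda>f. w f * card (e \<inter> f)"] by simp
  also have "(\<Sum>f\<in>F - {e}. w f * card (e \<inter> f)) = sum w (F - {e})"
    using extremal_linear[OF assms] by (intro sum.cong) auto
  also have "\<dots> = m - w e"
    using sum.remove[OF finite_edges assms, of w] m_def by simp
  finally have "(n + 1) * m / n = m + n * w e"
    using real_card_edge[OF assms] by (simp add: algebra_simps)
  then show ?thesis using n2 by (simp add: field_simps power2_eq_square)
qed

text \<open>Constant weights turn weighted counts into cardinalities: dividing the total
  \<open>m\<close> and the degree \<open>m / n\<close> by \<open>m / n\<^sup>2\<close> gives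
  \<open>n\<^sup>2\<close> and \<open>n\<close>.\<close>

lemma extremal_linear_system: "linear_partite_system F C n"
proof
  let ?b = "m / (real n)\<^sup>2"
  have b: "?b > 0" using m_pos n2 by simp
  show "card C = n + 1" by (rule card_C)
  show "0 < n" using n2 by simp
  have "m = (\<Sum>e\<in>F. w e)" by (rule m_def)
  also have "\<dots> = (\<Sum>e\<in>F. ?b)" by (intro sum.cong extremal_weight) auto
  also have "\<dots> = card F * ?b" by (rule sum_constant)
  finally have "m = card F * ?b" .
  then have "real (card F) = (real n)\<^sup>2" using m_pos n2 by (simp add: field_simps)
  then show "card F = n\<^sup>2" by (metis of_nat_eq_iff of_nat_power)
  show "card {e\<in>F. v \<in> e} = n" if "v \<in> \<Union>F" for v
  proof -
    have "m / n = (\<Sum>e\<in>{e\<in>F. v \<in> e}. w e)" by (rule degree_eq[OF that, symmetric])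
    also have "\<dots> = (\<Sum>e\<in>{e\<in>F. v \<in> e}. ?b)" by (intro sum.cong extremal_weight) auto
    finally have "m / n = card {e\<in>F. v \<in> e} * ?b" by simp
    then have "real (card {e\<in>F. v \<in> e}) = real n"
      using m_pos n2 by (simp add: field_simps power2_eq_square)
    then show ?thesis by simp
  qed
  show "card (e \<inter> f) = 1" if "e \<in> F" "f \<in> F" "e \<noteq> f" for e f
    by (rule extremal_linear[OF that])
qed

end

end

section \<open>Counting in projective planes and their truncations\<close>

context
  fixes n :: nat and P :: "'a set" and L :: "'a set set"
  assumes plane: "projective_plane n P L"
begin

lemmas plane_conjuncts = plane[unfolded projective_plane_def]

lemma plane_line: "l \<in> L \<Longrightarrow> l \<subseteq> P" "l \<in> L \<Longrightarrow> card l = n + 1"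
  using plane_conjuncts[THEN conjunct2, THEN conjunct1] by auto

lemma plane_finite: "finite P" "finite L"
proof -
  show "finite P" by (rule plane_conjuncts[THEN conjunct1])
  moreover have "L \<subseteq> Pow P" using plane_line(1) by auto
  ultimately show "finite L" by (simp add: finite_subset)
qed

lemma plane_join_ex: assumes "x \<in> P" "y \<in> P" "x \<noteq> y" shows "\<exists>l\<in>L. x \<in> l \<and> y \<in> l"
proof -
  have "\<exists>!l. l \<in> L \<and> x \<in> l \<and> y \<in> l"
    using plane_conjuncts[THEN conjunct2, THEN conjunct2, THEN conjunct1] assms by simp
  then show ?thesis by auto
qed

lemma plane_meet: assumes "l \<in> L" "m \<in> L" "l \<noteq> m" shows "\<exists>!x. x \<in> l \<and> x \<in> m"
  using plane_conjuncts[THEN conjunct2, THEN conjunct2, THEN conjunct2, THEN conjunct1] assms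
  by simp

lemma plane_nondegenerate:
  obtains x y z where "x \<in> P" "y \<in> P" "z \<in> P" "x \<noteq> y" "x \<noteq> z" "y \<noteq> z"
    "\<And>l. \<lbrakk>l \<in> L; x \<in> l; y \<in> l; z \<in> l\<rbrakk> \<Longrightarrow> False"
  using plane_conjuncts[THEN conjunct2, THEN conjunct2, THEN conjunct2, THEN conjunct2] by metis

lemma plane_meet_unique: "\<lbrakk>l \<in> L; m \<in> L; l \<noteq> m; x \<in> l; x \<in> m; y \<in> l; y \<in> m\<rbrakk> \<Longrightarrow> x = y"
  using plane_meet by blast

lemma plane_meet_ex: "\<lbrakk>l \<in> L; m \<in> L; l \<noteq> m\<rbrakk> \<Longrightarrow> \<exists>x. x \<in> l \<and> x \<in> m"
  using plane_meet by blast

text \<open>Otherwise the three sides of a triangle would all pass through \<open>x\<close>, which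
  would then be two of its corners at once.\<close>

lemma plane_line_avoiding: "\<exists>l\<in>L. x \<notin> l"
proof (rule ccontr)
  assume all: "\<not> (\<exists>l\<in>L. x \<notin> l)"
  obtain a b c where abc: "a \<in> P" "b \<in> P" "c \<in> P" "a \<noteq> b" "a \<noteq> c" "b \<noteq> c"
    "\<And>l. \<lbrakk>l \<in> L; a \<in> l; b \<in> l; c \<in> l\<rbrakk> \<Longrightarrow> False"
    by (rule plane_nondegenerate) blast
  obtain l where l: "l \<in> L" "a \<in> l" "b \<in> l" using plane_join_ex[OF abc(1,2,4)] by blast
  obtain m where m: "m \<in> L" "a \<in> m" "c \<in> m" using plane_join_ex[OF abc(1,3,5)] by blast
  obtain k where k: "k \<in> L" "b \<in> k" "c \<in> k" using plane_join_ex[OF abc(2,3,6)] by blast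
  have x: "x \<in> l" "x \<in> m" "x \<in> k" using all l m k by auto
  have "l \<noteq> m" "l \<noteq> k" using l m k abc by auto
  then have "x = a" "x = b"
    using plane_meet_unique[OF l(1) m(1) _ x(1,2) l(2) m(2)]
      plane_meet_unique[OF l(1) k(1) _ x(1,3) l(3) k(2)] by auto
  then show False using abc by simp
qed

text \<open>Projection from \<open>x\<close> onto a line \<open>l\<close> avoiding it matches the
  lines through \<open>x\<close> with the points of \<open>l\<close>.\<close>

lemma plane_degree:
  assumes "x \<in> P" shows "card {m\<in>L. x \<in> m} = n + 1"
proof -
  obtain l where l: "l \<in> L" "x \<notin> l" using plane_line_avoiding by auto
  have "\<forall>y\<in>l. \<exists>m. m \<in> L \<and> x \<in> m \<and> y \<in> m"
    using plane_join_ex[OF assms] plane_line(1)[OF l(1)] l(2) by blast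
  then obtain h where h: "\<And>y. y \<in> l \<Longrightarrow> h y \<in> L \<and> x \<in> h y \<and> y \<in> h y"
    by (metis bchoice)
  have "inj_on h l"
  proof (rule inj_onI)
    fix y z assume yz: "y \<in> l" "z \<in> l" "h y = h z"
    have "h y \<noteq> l" using h[OF yz(1)] l by auto
    then show "y = z" using plane_meet_unique[of "h y" l y z] h[OF yz(1)] h[OF yz(2)] l yz by auto
  qed
  moreover have "h ` l = {m\<in>L. x \<in> m}"
  proof (intro equalityI subsetI)
    fix m assume "m \<in> h ` l" then show "m \<in> {m\<in>L. x \<in> m}" using h by auto
  next
    fix m assume "m \<in> {m\<in>L. x \<in> m}"
    then have m: "m \<in> L" "x \<in> m" by auto
    then have "m \<noteq> l" using l by auto
    then obtain y where y: "y \<in> m" "y \<in> l" using plane_meet_ex[OF m(1) l(1)] by auto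
    then have "x \<noteq> y" using l by auto
    then have "h y = m" using plane_meet_unique[of "h y" m x y] h[OF y(2)] m y by auto
    then show "m \<in> h ` l" using y by auto
  qed
  ultimately have "card {m\<in>L. x \<in> m} = card l" by (metis card_image)
  then show ?thesis using plane_line(2)[OF l(1)] by simp
qed

lemma plane_card_points:
  assumes "x \<in> P" shows "card P = n\<^sup>2 + n + 1"
proof -
  have U: "P - {x} = (\<Union>l\<in>{m\<in>L. x \<in> m}. l - {x})"
    using plane_join_ex[OF assms] plane_line(1) by blast
  have "card (P - {x}) = (\<Sum>l\<in>{m\<in>L. x \<in> m}. card (l - {x}))"
    unfolding U
  proof (intro card_UN_disjoint ballI impI)
    show "finite {m\<in>L. x \<in> m}" using plane_finite by simp
    show "finite (l - {x})" if "l \<in> {m\<in>L. x \<in> m}" for l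
      using that plane_line(1) plane_finite by (auto intro: finite_subset)
    show "(l - {x}) \<inter> (m - {x}) = {}"
      if "l \<in> {m\<in>L. x \<in> m}" "m \<in> {m\<in>L. x \<in> m}" "l \<noteq> m" for l m
      using that plane_meet_unique[of l m _ x] by blast
  qed
  also have "\<dots> = (\<Sum>l\<in>{m\<in>L. x \<in> m}. n)"
    using plane_line(2) by (intro sum.cong) auto
  also have "\<dots> = (n + 1) * n" using plane_degree[OF assms] by simp
  finally have "card P = Suc ((n + 1) * n)" using card_Suc_Diff1[OF plane_finite(1) assms] by simp
  then show ?thesis by (simp add: power2_eq_square)
qed

text \<open>Counting incident pairs in two ways: both points and lines have \<open>n + 1\<close>
  incidences each, so there are equally many of them.\<close>

lemma plane_card_lines: "card L = n\<^sup>2 + n + 1"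
proof -
  obtain x where x: "x \<in> P" by (rule plane_nondegenerate)
  have "(\<Sum>x\<in>P. \<Sum>l\<in>{l\<in>L. x \<in> l}. 1) = (\<Sum>l\<in>L. \<Sum>x\<in>{x\<in>P. x \<in> l}. 1::nat)"
    by (rule sum.swap_restrict[OF plane_finite])
  moreover have "{x\<in>P. x \<in> l} = l" if "l \<in> L" for l using plane_line(1)[OF that] by auto
  ultimately have "(\<Sum>x\<in>P. n + 1) = (\<Sum>l\<in>L. n + 1)"
    using plane_degree plane_line(2) by simp
  then have "card P * (n + 1) = card L * (n + 1)" by simp
  then have "card P = card L" by (simp only: mult_cancel2) simp
  then show ?thesis using plane_card_points[OF x] by simp
qed

text \<open>Serves to move the completed plane from \<open>'a option\<close> to
  \<open>nat\<close>.\<close>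

lemma plane_image:
  assumes g: "inj_on g P"
  shows "projective_plane n (g ` P) ((`) g ` L)"
proof -
  have inL: "g x \<in> g ` l \<longleftrightarrow> x \<in> l" if "x \<in> P" "l \<in> L" for x l
    using inj_on_image_mem_iff[OF g that(1) plane_line(1)[OF that(2)]] .
  have "k \<subseteq> g ` P \<and> card k = n + 1" if k: "k \<in> (`) g ` L" for k
  proof -
    obtain l where l: "l \<in> L" "k = g ` l" using k by auto
    then show ?thesis
      using plane_line[OF l(1)] card_image[OF inj_on_subset[OF g plane_line(1)[OF l(1)]]]
      by auto
  qed
  moreover have "\<exists>!k. k \<in> (`) g ` L \<and> x \<in> k \<and> y \<in> k" if "x \<in> g ` P" "y \<in> g ` P" "x \<noteq> y" for x y
  proof -
    obtain a b where ab: "a \<in> P" "b \<in> P" "x = g a" "y = g b" "a \<noteq> b"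
      using \<open>x \<in> g ` P\<close> \<open>y \<in> g ` P\<close> \<open>x \<noteq> y\<close> by auto
    obtain l where l: "l \<in> L" "a \<in> l" "b \<in> l" using plane_join_ex[OF ab(1,2,5)] by auto
    show ?thesis
    proof (rule ex1I[of _ "g ` l"])
      show "g ` l \<in> (`) g ` L \<and> x \<in> g ` l \<and> y \<in> g ` l" using l ab by auto
      fix k assume k: "k \<in> (`) g ` L \<and> x \<in> k \<and> y \<in> k"
      then obtain m where m: "m \<in> L" "k = g ` m" by auto
      then have "a \<in> m" "b \<in> m" using inL ab k by auto
      then have "m = l" using plane_meet_unique[OF m(1) l(1) _ _ l(2) _ l(3)] ab(5) by auto
      then show "k = g ` l" using m by simp
    qed
  qed
  moreover have "\<exists>!x. x \<in> k \<and> x \<in> k'" if "k \<in> (`) g ` L" "k' \<in> (`) g ` L" "k \<noteq> k'" for k k'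
  proof -
    obtain l m where lm: "l \<in> L" "m \<in> L" "k = g ` l" "k' = g ` m" "l \<noteq> m"
      using \<open>k \<in> (`) g ` L\<close> \<open>k' \<in> (`) g ` L\<close> \<open>k \<noteq> k'\<close> by auto
    obtain z where z: "z \<in> l" "z \<in> m" using plane_meet_ex[OF lm(1,2,5)] by auto
    show ?thesis
    proof (rule ex1I[of _ "g z"])
      show "g z \<in> k \<and> g z \<in> k'" using lm z by auto
      fix y assume y: "y \<in> k \<and> y \<in> k'"
      then obtain a where a: "a \<in> l" "y = g a" using lm by auto
      then have "a \<in> m" using inL[of a m] plane_line(1)[OF lm(1)] lm y by auto
      then show "y = g z" using plane_meet_unique[OF lm(1,2,5) a(1) _ z] a by simp
    qed
  qed
  moreover have "\<exists>x\<in>g ` P. \<exists>y\<in>g ` P. \<exists>z\<in>g ` P. x \<noteq> y \<and> x \<noteq> z \<and> y \<noteq> z \<and>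
      \<not> (\<exists>l\<in>(`) g ` L. x \<in> l \<and> y \<in> l \<and> z \<in> l)"
  proof -
    obtain a b c where abc: "a \<in> P" "b \<in> P" "c \<in> P" "a \<noteq> b" "a \<noteq> c" "b \<noteq> c"
      "\<And>l. \<lbrakk>l \<in> L; a \<in> l; b \<in> l; c \<in> l\<rbrakk> \<Longrightarrow> False"
      by (rule plane_nondegenerate) blast
    have "\<not> (\<exists>l\<in>(`) g ` L. g a \<in> l \<and> g b \<in> l \<and> g c \<in> l)"
      using abc inL by auto
    then show ?thesis using abc inj_on_eq_iff[OF g]
      by (rule_tac bexI[where x="g a"], rule_tac bexI[where x="g b"],
          rule_tac bexI[where x="g c"]) simp_all
  qed
  moreover have "finite (g ` P)" using plane_finite(1) by simp
  ultimately show ?thesis unfolding projective_plane_def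
    by (intro conjI ballI impI) simp_all
qed

end

text \<open>Deleting \<open>p\<close> deletes \<open>n + 1\<close> lines, and every other point
  loses exactly one line, its join with \<open>p\<close>. Surviving lines avoid \<open>p\<close>, so
  their intersection points survive.\<close>

lemma truncated_plane_counts:
  assumes "truncated_projective_plane n W F"
  shows "finite F" "\<Union>F \<subseteq> W" "card F = n\<^sup>2"
    "\<And>v. v \<in> W \<Longrightarrow> card {e\<in>F. v \<in> e} = n"
    "\<And>e f. \<lbrakk>e \<in> F; f \<in> F; e \<noteq> f\<rbrakk> \<Longrightarrow> card (e \<inter> f) = 1"
proof -
  obtain P L p where pl: "projective_plane n P L" "p \<in> P" and W: "W = P - {p}"
    and F: "F = {l\<in>L. p \<notin> l}"
    using assms unfolding truncated_projective_plane_def by blast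
  show "finite F" using plane_finite[OF pl(1)] F by simp
  show "\<Union>F \<subseteq> W" using plane_line(1)[OF pl(1)] F W by blast
  have "F = L - {l\<in>L. p \<in> l}" using F by auto
  then have "card F = card L - card {l\<in>L. p \<in> l}"
    using plane_finite[OF pl(1)] by (simp add: card_Diff_subset)
  then show "card F = n\<^sup>2"
    using plane_card_lines[OF pl(1)] plane_degree[OF pl] by simp
  show "card {e\<in>F. v \<in> e} = n" if "v \<in> W" for v
  proof -
    have v: "v \<in> P" "v \<noteq> p" using that W by auto
    then obtain l where l: "l \<in> L" "p \<in> l" "v \<in> l" using plane_join_ex[OF pl(1,2)] by blast
    have "m = l" if "m \<in> L" "p \<in> m" "v \<in> m" for m
      using plane_meet_unique[OF pl(1) that(1) l(1) _ that(2) l(2) that(3) l(3)] v by auto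
    then have "{e\<in>F. v \<in> e} = {m\<in>L. v \<in> m} - {l}" unfolding F using l(2) by blast
    then show ?thesis
      using plane_degree[OF pl(1) v(1)] plane_finite[OF pl(1)] l by simp
  qed
  show "card (e \<inter> f) = 1" if ne: "e \<in> F" "f \<in> F" "e \<noteq> f" for e f
  proof -
    have ef: "e \<in> L" "f \<in> L" using ne F by auto
    obtain x where "x \<in> e" "x \<in> f" using plane_meet_ex[OF pl(1) ef ne(3)] by auto
    then have "e \<inter> f = {x}" using plane_meet_unique[OF pl(1) ef ne(3)] by blast
    then show ?thesis by simp
  qed
qed

text \<open>The closure is renamed injectively into \<open>nat\<close> and truncated at the image of
  \<open>None\<close>. Every class line contains that point and no edge does, so exactly the edges
  remain; \<open>h\<close> undoes the renaming.\<close>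

lemma (in linear_partite_system) ex_truncated_plane:
  "\<exists>(W :: nat set) F' h. truncated_projective_plane n W F' \<and> bij_betw h W (\<Union>F) \<and> (`) h ` F' = F"
proof -
  let ?P = "insert None (Some ` \<Union>F)"
  let ?L1 = "(`) Some ` F"
  let ?L2 = "(\<lambda>A. insert None (Some ` (A \<inter> \<Union>F))) ` C"
  have fin: "finite ?P" using finite_vertices by simp
  obtain g :: "'a option \<Rightarrow> nat" where g: "inj_on g ?P"
    using finite_imp_inj_to_nat_seg[OF fin] by metis
  let ?k = "g \<circ> Some"
  have k: "inj_on ?k (\<Union>F)" using g by (auto intro!: comp_inj_on simp: inj_on_def)
  have pl: "projective_plane n (g ` ?P) ((`) g ` (?L1 \<union> ?L2))"
    by (rule plane_image[OF projective_plane_closure g])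
  have notin: "g None \<notin> ?k ` \<Union>F"
    using g by (auto simp: inj_on_def)
  have W: "?k ` \<Union>F = g ` ?P - {g None}"
    using notin by (auto simp: image_comp)
  have "(`) ?k ` F = {l\<in>(`) g ` (?L1 \<union> ?L2). g None \<notin> l}"
  proof (intro equalityI subsetI)
    fix l assume "l \<in> (`) ?k ` F"
    then obtain e where e: "e \<in> F" "l = ?k ` e" by auto
    then have "l = g ` Some ` e" by (simp add: image_comp)
    moreover have "g None \<notin> l" using e notin by auto
    ultimately show "l \<in> {l\<in>(`) g ` (?L1 \<union> ?L2). g None \<notin> l}" using e by blast
  next
    fix l assume "l \<in> {l\<in>(`) g ` (?L1 \<union> ?L2). g None \<notin> l}"
    then obtain e where "e \<in> F" "l = g ` Some ` e" by auto
    then show "l \<in> (`) ?k ` F" by (auto simp: image_comp)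
  qed
  then have "truncated_projective_plane n (?k ` \<Union>F) ((`) ?k ` F)"
    unfolding truncated_projective_plane_def using pl W by blast
  moreover have "bij_betw (inv_into (\<Union>F) ?k) (?k ` \<Union>F) (\<Union>F)"
    by (rule bij_betw_inv_into[OF inj_on_imp_bij_betw[OF k]])
  moreover have "inv_into (\<Union>F) ?k ` ?k ` e = e" if "e \<in> F" for e
    using that k by (intro inv_into_image_cancel) auto
  then have "(`) (inv_into (\<Union>F) ?k) ` (`) ?k ` F = F" by (auto simp: image_iff)
  ultimately show ?thesis by blast
qed

section \<open>Multiplicities, covered edges and the two directions\<close>

lemma num_covered_eq:
  "num_covered E S = sum (count E) {e\<in>set_mset E. S \<inter> e \<noteq> {}}"
  by (simp add: num_covered_def size_multiset_overloaded_eq Int_def)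

lemma covered_add_missed:
  "num_covered E S + sum (count E) {e\<in>set_mset E. S \<inter> e = {}} = size E"
proof -
  have "sum (count E) {e\<in>set_mset E. S \<inter> e \<noteq> {}} + sum (count E) {e\<in>set_mset E. S \<inter> e = {}}
      = sum (count E) (set_mset E)"
    by (subst sum.union_disjoint[symmetric]) (auto intro!: sum.cong)
  then show ?thesis by (simp add: num_covered_eq size_multiset_overloaded_eq)
qed

text \<open>An edge has \<open>r\<close> vertices, spread over \<open>r\<close> classes with at most
  one in each, so no class can be left out.\<close>

lemma partite_systemI:
  assumes "hypergraph V E" "partite r C V E" "uniform r E" "0 < r"
  shows "partite_system (set_mset E) C"
proof
  have C: "partition_on V C" "card C = r" and le1: "\<And>e A. \<lbrakk>e \<in># E; A \<in> C\<rbrakk> \<Longrightarrow> card (e \<inter> A) \<le> 1"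
    using assms(2) unfolding partite_def by auto
  \<comment> \<open>An infinite set has \<open>card\<close> 0, so \<open>0 < r\<close> forces
    finiteness.\<close>
  show fin: "finite C" using C(2) assms(4) card.infinite by fastforce
  show disj: "disjoint C" using C(1) unfolding partition_on_def by simp
  have un: "\<Union>C = V" using C(1) unfolding partition_on_def by simp
  show "\<Union>(set_mset E) \<subseteq> \<Union>C" using assms(1) un unfolding hypergraph_def by blast
  show "finite (set_mset E)" by simp
  show "card (e \<inter> A) = 1" if e: "e \<in># E" and A: "A \<in> C" for e A
  proof -
    have "e \<subseteq> V" "finite V" using assms(1) e unfolding hypergraph_def by auto
    then have "finite e" and eq: "(\<Union>A\<in>C. e \<inter> A) = e" using un by (auto intro: finite_subset)
    have "card (\<Union>A\<in>C. e \<inter> A) = (\<Sum>A\<in>C. card (e \<inter> A))"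
      using fin \<open>finite e\<close> disj by (intro card_UN_disjoint) (auto simp: disjoint_def)
    then have "(\<Sum>A\<in>C. card (e \<inter> A)) = r"
      using assms(3) e unfolding eq uniform_def by simp
    also have "r = (\<Sum>A\<in>C. 1)" using C(2) by simp
    finally have sum_eq: "(\<Sum>A\<in>C. card (e \<inter> A)) = (\<Sum>A\<in>C. 1)" .
    show ?thesis
    proof (rule ccontr)
      assume "card (e \<inter> A) \<noteq> 1"
      then have "card (e \<inter> A) < 1" using le1[OF e A] by simp
      then have "(\<Sum>A\<in>C. card (e \<inter> A)) < (\<Sum>A\<in>C. 1)"
        using fin A le1[OF e] by (intro sum_strict_mono_ex1) auto
      then show False using sum_eq by simp
    qed
  qed
qed

lemma multicolored_edge_minus:
  assumes "hypergraph V E" "partite r C V E" "uniform r E" "e \<in># E" "v \<in> e"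
  shows "multicolored V C (e - {v}) \<and> card (e - {v}) = r - 1"
proof -
  have e: "e \<subseteq> V" "finite e" "card e = r"
    using assms unfolding hypergraph_def uniform_def by (auto intro: finite_subset)
  have "card ((e - {v}) \<inter> A) \<le> 1" if "A \<in> C" for A
  proof -
    have "card ((e - {v}) \<inter> A) \<le> card (e \<inter> A)" using e by (intro card_mono) auto
    also have "\<dots> \<le> 1" using assms(2,4) that unfolding partite_def by blast
    finally show ?thesis .
  qed
  then show ?thesis using e assms(5) unfolding multicolored_def by auto
qed

lemma finite_multicolored:
  assumes "hypergraph V E"
  shows "finite {S. multicolored V C S \<and> card S = k}"
proof -
  have "{S. multicolored V C S \<and> card S = k} \<subseteq> Pow V" unfolding multicolored_def by auto
  then show ?thesis using assms finite_subset unfolding hypergraph_def by blast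
qed

lemma num_covered_le_max:
  assumes "hypergraph V E" "multicolored V C S" "card S = k"
  shows "num_covered E S \<le> max_covered k V C E"
  unfolding max_covered_def
  using finite_multicolored[OF assms(1)] assms(2,3) by (intro Max_ge) auto

lemma max_covered_eqI:
  assumes "hypergraph V E" "multicolored V C S" "card S = k" "num_covered E S = c"
    and "\<And>S. \<lbrakk>multicolored V C S; card S = k\<rbrakk> \<Longrightarrow> num_covered E S \<le> c"
  shows "max_covered k V C E = c"
  unfolding max_covered_def
  using finite_multicolored[OF assms(1)] assms(2-5) by (intro Max_eqI) auto

lemma non_isolated_eq: "hypergraph V E \<Longrightarrow> non_isolated V E = \<Union>(set_mset E)"
  unfolding non_isolated_def hypergraph_def by auto

lemma image_repeat_mset_set:
  assumes "inj_on f F"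
  shows "image_mset f (repeat_mset b (mset_set F)) = repeat_mset b (mset_set (f ` F))"
proof -
  have "image_mset f (repeat_mset b M) = repeat_mset b (image_mset f M)" for M :: "'a multiset"
    by (induction b) auto
  then show ?thesis using assms by (simp add: image_mset_mset_set)
qed

lemma inj_on_image_Pow:
  assumes "inj_on h W" "\<Union>F \<subseteq> W"
  shows "inj_on ((`) h) F"
  using inj_on_image[OF inj_on_subset[OF assms]] .

lemma multiset_eq_repeat:
  assumes "\<And>e. e \<in># E \<Longrightarrow> count E e = b"
  shows "E = repeat_mset b (mset_set (set_mset E))"
proof (rule multiset_eqI)
  fix x show "count E x = count (repeat_mset b (mset_set (set_mset E))) x"
    using assms[of x] by (cases "x \<in># E") (auto simp: count_eq_zero_iff)
qed

lemma copies_if_linear: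
  assumes lin: "linear_partite_system (set_mset E) C n"
    and b: "\<And>e. e \<in># E \<Longrightarrow> count E e = b"
  shows "copies_of_truncated_plane n (\<Union>(set_mset E)) E"
proof -
  obtain W :: "nat set" and F' h where t: "truncated_projective_plane n W F'"
    and h: "bij_betw h W (\<Union>(set_mset E))" "(`) h ` F' = set_mset E"
    using linear_partite_system.ex_truncated_plane[OF lin] by blast
  obtain e where e: "e \<in># E" using linear_partite_system.edges_nonempty[OF lin] by auto
  then have bpos: "b > 0" using b[OF e] by (metis count_greater_zero_iff)
  have "inj_on ((`) h) F'"
    using bij_betw_imp_inj_on[OF h(1)] truncated_plane_counts(2)[OF t] by (rule inj_on_image_Pow)
  then have "image_mset ((`) h) (repeat_mset b (mset_set F')) = repeat_mset b (mset_set (set_mset E))"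
    using image_repeat_mset_set h(2) by metis
  also have "\<dots> = E" using multiset_eq_repeat[of E b, OF b] by simp
  finally show ?thesis
    unfolding copies_of_truncated_plane_def isomorphic_def using t bpos h(1) by blast
qed

text \<open>An isomorphism transports sizes, degrees and intersections but says nothing about
  classes. The classes are those of \<open>C\<close>, whose property of meeting each edge once comes
  from \<open>sys\<close>.\<close>

lemma linear_if_copies:
  assumes sys: "partite_system (set_mset E) C" and C: "card C = n + 1" and n: "0 < n"
    and copies: "copies_of_truncated_plane n (\<Union>(set_mset E)) E"
  obtains b where "linear_partite_system (set_mset E) C n" "\<And>e. e \<in># E \<Longrightarrow> count E e = b"
proof -
  let ?F = "set_mset E"
  obtain W :: "nat set" and F' b h where t: "truncated_projective_plane n W F'" and b: "b > 0"
    and h: "bij_betw h W (\<Union>?F)" and E: "image_mset ((`) h) (repeat_mset b (mset_set F')) = E"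
    using copies unfolding copies_of_truncated_plane_def isomorphic_def by blast
  note t' = truncated_plane_counts[OF t]
  have hi: "inj_on h W" "h ` W = \<Union>?F" using h by (auto simp: bij_betw_def)
  have sub: "e \<subseteq> W" if "e \<in> F'" for e using t'(2) that by auto
  have injF: "inj_on ((`) h) F'" using hi(1) t'(2) by (rule inj_on_image_Pow)
  have Eb: "E = repeat_mset b (mset_set ((`) h ` F'))"
    using E image_repeat_mset_set[OF injF] by simp
  have cnt: "count E e = (if e \<in> (`) h ` F' then b else 0)" for e
    unfolding Eb using t'(1) by simp
  then have F: "?F = (`) h ` F'" using b by (auto simp: set_mset_def split: if_splits)
  interpret partite_system ?F C by (rule sys)
  have "linear_partite_system ?F C n"
  proof
    show "card C = n + 1" "0 < n" by fact+
    show "card ?F = n\<^sup>2" unfolding F using t'(3) injF by (simp add: card_image)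
    show "card {e\<in>?F. v \<in> e} = n" if v: "v \<in> \<Union>?F" for v
    proof -
      obtain u where u: "u \<in> W" "v = h u" using v hi(2) by blast
      have "{e\<in>?F. v \<in> e} = (`) h ` {e\<in>F'. u \<in> e}"
        unfolding F u(2) using inj_on_image_mem_iff[OF hi(1) u(1) sub] by auto
      moreover have "inj_on ((`) h) {e\<in>F'. u \<in> e}" using injF by (rule inj_on_subset) auto
      ultimately show ?thesis using t'(4)[OF u(1)] by (simp add: card_image)
    qed
    show "card (e \<inter> f) = 1" if ef: "e \<in> ?F" "f \<in> ?F" "e \<noteq> f" for e f
    proof -
      obtain e' f' where e'f': "e' \<in> F'" "f' \<in> F'" "e = h ` e'" "f = h ` f'"
        using ef unfolding F by blast
      have "e \<inter> f = h ` (e' \<inter> f')"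
        using inj_on_image_Int[OF hi(1) sub[OF e'f'(1)] sub[OF e'f'(2)]] e'f' by simp
      moreover have "inj_on h (e' \<inter> f')"
        using sub[OF e'f'(1)] by (intro inj_on_subset[OF hi(1)]) auto
      moreover have "card (e' \<inter> f') = 1" using t'(5)[OF e'f'(1,2)] ef(3) e'f' by auto
      ultimately show ?thesis by (simp add: card_image)
    qed
  qed
  moreover have "count E e = b" if "e \<in># E" for e using cnt[of e] that F by simp
  ultimately show thesis by (rule that)
qed

lemma max_covered_linear:
  assumes hyp: "hypergraph V E" "partite (n + 1) C V E" "uniform (n + 1) E"
    and lin: "linear_partite_system (set_mset E) C n"
    and b: "\<And>e. e \<in># E \<Longrightarrow> count E e = b"
  shows "real (max_covered n V C E) = (1 - (real n - 1) / (real n)\<^sup>2) * real (size E)"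
proof -
  interpret linear_partite_system "set_mset E" C n by (rule lin)
  have sum_b: "sum (count E) {e\<in>set_mset E. Q e} = card {e\<in>set_mset E. Q e} * b" for Q
    using b by simp
  obtain e where e: "e \<in># E" using edges_nonempty by auto
  have "card e \<noteq> 0" using card_edge[OF e] card_classes by simp
  then obtain v where v: "v \<in> e" by fastforce
  have size: "size E = n\<^sup>2 * b"
    using b card_edges by (simp add: size_multiset_overloaded_eq)
  \<comment> \<open>Covered plus missed distinct edges give all edges, so the upper bound of
    \<open>card_covered_le\<close> is attained by \<open>e - {v}\<close>.\<close>
  have n2: "n + (n - 1) * (n - 1) + (n - 1) = n\<^sup>2"
    using n_pos by (cases n) (simp_all add: power2_eq_square)
  have "max_covered n V C E = (n + (n - 1) * (n - 1)) * b"
  proof (rule max_covered_eqI[OF hyp(1)])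
    show "multicolored V C (e - {v})" "card (e - {v}) = n"
      using multicolored_edge_minus[OF hyp e v] by auto
    have "num_covered E (e - {v}) + (n - 1) * b = n\<^sup>2 * b"
      using covered_add_missed[of E "e - {v}"] card_missed[OF e v] size by (simp add: sum_b)
    also have "\<dots> = (n + (n - 1) * (n - 1)) * b + (n - 1) * b"
      unfolding n2[symmetric] by (simp add: distrib_right)
    finally show "num_covered E (e - {v}) = (n + (n - 1) * (n - 1)) * b" by simp
  next
    fix S assume S: "multicolored V C S" "card S = n"
    have "V = \<Union>C" using hyp(2) unfolding partite_def partition_on_def by auto
    then have "card {e\<in>set_mset E. S \<inter> e \<noteq> {}} \<le> n + (n - 1) * (n - 1)"
      using S n_pos unfolding multicolored_def
      by (intro card_covered_le) (auto intro: card_ge_0_finite)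
    then show "num_covered E S \<le> (n + (n - 1) * (n - 1)) * b"
      unfolding num_covered_eq sum_b by (rule mult_right_mono) simp
  qed
  then have "real (max_covered n V C E) = (real n + (real n - 1) * (real n - 1)) * b"
    using n_pos by (simp add: of_nat_diff)
  also have "\<dots> = (1 - (real n - 1) / (real n)\<^sup>2) * real (n\<^sup>2 * b)"
    using n_pos by (simp add: field_simps power2_eq_square)
  finally show ?thesis unfolding size .
qed

text \<open>The maximum bounds what each \<open>e - {v}\<close> covers; taking complements yields
  \<open>missed\<close>, with multiplicities as weights. Equal weights then provide the common
  number of copies.\<close>

lemma copies_if_max_covered:
  assumes hyp: "hypergraph V E" "partite (n + 1) C V E" "uniform (n + 1) E" "intersecting E"
    "E \<noteq> {#}" and n: "2 \<le> n"
    and max: "real (max_covered n V C E) = (1 - (real n - 1) / (real n)\<^sup>2) * real (size E)"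
  shows "copies_of_truncated_plane n (\<Union>(set_mset E)) E"
proof -
  let ?F = "set_mset E" and ?w = "\<lambda>e. real (count E e)"
  interpret partite_system ?F C using partite_systemI[OF hyp(1-3)] by simp
  have C: "card C = n + 1" using hyp(2) unfolding partite_def by simp
  have size: "real (size E) = sum ?w ?F" by (simp add: size_multiset_overloaded_eq)
  have pos: "0 < ?w e" if "e \<in> ?F" for e using that by simp
  have meet: "e \<inter> f \<noteq> {}" if "e \<in> ?F" "f \<in> ?F" for e f
    using hyp(4) that unfolding intersecting_def by blast
  have missed: "(real n - 1) / (real n)\<^sup>2 * size E \<le> sum ?w {f\<in>?F. (e - {v}) \<inter> f = {}}"
    if "e \<in> ?F" "v \<in> e" for e v
  proof -
    have "num_covered E (e - {v}) \<le> max_covered n V C E"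
      using multicolored_edge_minus[OF hyp(1-3) that] num_covered_le_max[OF hyp(1)] by simp
    then have "real (num_covered E (e - {v})) \<le> (1 - (real n - 1) / (real n)\<^sup>2) * size E"
      using max by simp
    moreover have "real (num_covered E (e - {v})) + sum ?w {f\<in>?F. (e - {v}) \<inter> f = {}} = size E"
      using covered_add_missed[of E "e - {v}"] by (simp flip: of_nat_sum of_nat_add)
    ultimately show ?thesis by (simp add: algebra_simps)
  qed
  have ne: "?F \<noteq> {}" using hyp(5) by simp
  note prems = C n ne pos size meet missed
  have lin: "linear_partite_system ?F C n" by (rule extremal_linear_system[OF prems])
  have w: "?w e = size E / (real n)\<^sup>2" if "e \<in> ?F" for e
    by (rule extremal_weight[OF prems that])
  obtain e0 where "e0 \<in> ?F" using ne by auto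
  then have "count E e = count E e0" if "e \<in> ?F" for e
    using w[OF that] w[of e0] by simp
  then show ?thesis using copies_if_linear[OF lin] by blast
qed

theorem theorem12:
  fixes r :: nat and V :: "'a set" and C :: "'a set set" and E :: "'a set multiset"
  assumes "r \<ge> 2"
    and "hypergraph V E"
    and "partite r C V E"
    and "uniform r E"
    and "intersecting E"
    and "E \<noteq> {#}"
  shows "(r \<ge> 3 \<longrightarrow>
            (real (max_covered (r - 1) V C E)
               = (1 - (real r - 2) / (real r - 1)\<^sup>2) * real (size E)
             \<longleftrightarrow> copies_of_truncated_plane (r - 1) (non_isolated V E) E)) \<and>
         (r = 2 \<longrightarrow>
            copies_of_truncated_plane (r - 1) (non_isolated V E) E \<longrightarrow>
            real (max_covered (r - 1) V C E)
               = (1 - (real r - 2) / (real r - 1)\<^sup>2) * real (size E))"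
proof -
  define n where "n = r - 1"
  have n: "r = n + 1" "0 < n" using assms(1) unfolding n_def by auto
  have r: "real r - 2 = real n - 1" "real r - 1 = real n" using n by auto
  note hyp = assms(2-4)[unfolded n(1)]
  have C: "card C = n + 1" using hyp(2) unfolding partite_def by simp
  have sys: "partite_system (set_mset E) C" using partite_systemI[OF hyp] by simp
  have "real (max_covered n V C E) = (1 - (real n - 1) / (real n)\<^sup>2) * real (size E)"
    if copies: "copies_of_truncated_plane n (\<Union>(set_mset E)) E"
    using linear_if_copies[OF sys C n(2) copies] max_covered_linear[OF hyp] by metis
  \<comment> \<open>\<open>r \<ge> 3\<close> supplies \<open>n \<ge> 2\<close>, as the extremal
    argument requires.\<close>
  moreover have "copies_of_truncated_plane n (\<Union>(set_mset E)) E"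
    if "r \<ge> 3" "real (max_covered n V C E) = (1 - (real n - 1) / (real n)\<^sup>2) * real (size E)"
    using copies_if_max_covered[OF hyp assms(5,6) _ that(2)] that(1) n by simp
  ultimately show ?thesis
    unfolding r n_def[symmetric] non_isolated_eq[OF assms(2)] by blast
qed

end
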